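(* Let $n\ge 1$ and $T=e_1T_1+e_2T_2\in L_1^n\times_eL_1^n$. Then a modified eigenvalue of $T$ exists if and only if an eigenvalue of $T$ exists.
   Context: $\mathbb{C}_1$ denotes the complex numbers with imaginary unit $i_1$. The bicomplex numbers are $\mathbb{C}_2=\{z_1+i_2z_2 : z_1,z_2\in\mathbb{C}_1\}$, a commutative $\mathbb{C}_1$-algebra with $i_1^2=i_2^2=-1$, $i_1i_2=i_2i_1$. Put $e_1=(1+i_1i_2)/2$ and $e_2=(1-i_1i_2)/2$; these are idempotents with $e_1+e_2=1$, $e_1e_2=0$. Every $\xi=z_1+i_2z_2\in\mathbb{C}_2$ is uniquely $\xi=\xi^-e_1+\xi^+e_2$ with $\xi^-=z_1-i_1z_2$, $\xi^+=z_1+i_1z_2\in\mathbb{C}_1$. $\mathbb{C}_2^n$ is regarded as a vector space over $\mathbb{C}_1$; bicomplex scalars act on it componentwise. $L_1^n$ is the set of $\mathbb{C}_1$-linear operators $\mathbb{C}_1^n\to\mathbb{C}_1^n$. For $T_1,T_2\in L_1^n$, $T=e_1T_1+e_2T_2$ is the $\mathbb{C}_1$-linear operator on $\mathbb{C}_2^n$ given by $T(\xi_1,\dots,\xi_n)=e_1T_1(\xi_1^-,\dots,\xi_n^-)+e_2T_2(\xi_1^+,\dots,\xi_n^+)$, and $L_1^n\times_eL_1^n$ is the set of all such operators. A scalar $\lambda\in\mathbb{C}_1$ is an eigenvalue of $T$ if there is a nonzero $x\in\mathbb{C}_2^n$ with $T(x)=\lambda x$. A scalar $\kappa\in\mathbb{C}_2$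 is a modified eigenvalue of $T$ if there is a nonzero $x\in\mathbb{C}_2^n$ with $T(x)=\kappa x$. *)

theory Defs
  imports "HOL-Analysis.Analysis"
begin

text \<open>\<open>Bicomplex z\<^sub>1 z\<^sub>2\<close> stands for \<open>z\<^sub>1 + i\<^sub>2 z\<^sub>2\<close>; the type \<open>complex\<close> is \<open>\<complex>\<^sub>1\<close>.\<close>

datatype bicomplex = Bicomplex (cpart1: complex) (cpart2: complex)

instantiation bicomplex :: comm_ring_1
begin

definition "0 = Bicomplex 0 0"
definition "1 = Bicomplex 1 0"
definition "x + y = Bicomplex (cpart1 x + cpart1 y) (cpart2 x + cpart2 y)"
definition "- x = Bicomplex (- cpart1 x) (- cpart2 x)"
definition "x - y = Bicomplex (cpart1 x - cpart1 y) (cpart2 x - cpart2 y)"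
definition "x * y = Bicomplex (cpart1 x * cpart1 y - cpart2 x * cpart2 y)
                              (cpart1 x * cpart2 y + cpart2 x * cpart1 y)"

instance
  by standard
    (simp_all add: zero_bicomplex_def one_bicomplex_def plus_bicomplex_def
      uminus_bicomplex_def minus_bicomplex_def times_bicomplex_def algebra_simps bicomplex.expand)

end

lemmas bicomplex_defs = zero_bicomplex_def one_bicomplex_def plus_bicomplex_def
  uminus_bicomplex_def minus_bicomplex_def times_bicomplex_def

definition of_C1 :: "complex \<Rightarrow> bicomplex" where
  "of_C1 z = Bicomplex z 0"

definition i1 :: bicomplex where
  "i1 = of_C1 \<i>"

definition i2 :: bicomplex where
  "i2 = Bicomplex 0 1"

text \<open>The factor \<open>of_C1 (1/2)\<close> replaces a division by 2, as \<open>bicomplex\<close> is only a ring.\<close>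

definition e1 :: bicomplex where
  "e1 = of_C1 (1/2) * (1 + i1 * i2)"

definition e2 :: bicomplex where
  "e2 = of_C1 (1/2) * (1 - i1 * i2)"

definition minus_part :: "bicomplex \<Rightarrow> complex" where
  "minus_part \<xi> = cpart1 \<xi> - \<i> * cpart2 \<xi>"

definition plus_part :: "bicomplex \<Rightarrow> complex" where
  "plus_part \<xi> = cpart1 \<xi> + \<i> * cpart2 \<xi>"

lemma bicomplex_cartesian: "\<xi> = of_C1 (cpart1 \<xi>) + i2 * of_C1 (cpart2 \<xi>)"
  by (cases \<xi>) (simp add: bicomplex_defs of_C1_def i2_def)

lemma imaginary_units: "i1 * i1 = - 1" "i2 * i2 = - 1"
  by (simp_all add: bicomplex_defs of_C1_def i1_def i2_def)

lemma idempotents: "e1 * e1 = e1" "e2 * e2 = e2" "e1 + e2 = 1" "e1 * e2 = 0"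
  by (simp_all add: e1_def e2_def bicomplex_defs of_C1_def i1_def i2_def field_simps)

lemma idempotent_decomposition:
  "\<xi> = of_C1 a * e1 + of_C1 b * e2 \<longleftrightarrow> a = minus_part \<xi> \<and> b = plus_part \<xi>"
proof -
  have "\<xi> = of_C1 a * e1 + of_C1 b * e2 \<longleftrightarrow>
      cpart1 \<xi> = (a + b) / 2 \<and> cpart2 \<xi> = \<i> * (a - b) / 2"
    by (cases \<xi>)
      (simp add: e1_def e2_def bicomplex_defs of_C1_def i1_def i2_def add_divide_distrib
        diff_divide_distrib algebra_simps)
  also have "\<dots> \<longleftrightarrow> a = minus_part \<xi> \<and> b = plus_part \<xi>"
    by (auto simp: minus_part_def plus_part_def complex_eq_iff field_simps)
  finally show ?thesis .
qed

text \<open>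
  Vectors in \<open>\<complex>\<^sub>2\<^sup>n\<close> have type \<open>bicomplex ^ 'n\<close>. A bicomplex scalar \<open>\<kappa>\<close> acts by \<open>\<kappa> *s x\<close> and
  a scalar \<open>\<mu>\<close> in \<open>\<complex>\<^sub>1\<close> by \<open>of_C1 \<mu> *s x\<close>.
\<close>

definition L1 :: "(complex ^ 'n \<Rightarrow> complex ^ 'n) set" where
  "L1 = {S. Vector_Spaces.linear (*s) (*s) S}"

definition e_combine ::
    "(complex ^ 'n \<Rightarrow> complex ^ 'n) \<Rightarrow> (complex ^ 'n \<Rightarrow> complex ^ 'n) \<Rightarrow>
     bicomplex ^ 'n \<Rightarrow> bicomplex ^ 'n" where
  "e_combine T1 T2 x =
     e1 *s (\<chi> i. of_C1 (T1 (\<chi> j. minus_part (x $ j)) $ i)) +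
     e2 *s (\<chi> i. of_C1 (T2 (\<chi> j. plus_part (x $ j)) $ i))"

lemma e_combine_linear:
  assumes "T1 \<in> L1" "T2 \<in> L1"
  shows "e_combine T1 T2 (x + y) = e_combine T1 T2 x + e_combine T1 T2 y"
    and "e_combine T1 T2 (of_C1 c *s x) = of_C1 c *s e_combine T1 T2 x"
proof -
  interpret T1: Vector_Spaces.linear "(*s)" "(*s)" T1 using assms by (simp add: L1_def)
  interpret T2: Vector_Spaces.linear "(*s)" "(*s)" T2 using assms by (simp add: L1_def)
  have *: "of_C1 (a + b) = of_C1 a + of_C1 b" "of_C1 (a * b) = of_C1 a * of_C1 b" for a b
    by (simp_all add: of_C1_def bicomplex_defs)
  have "(\<chi> j. minus_part ((x + y) $ j)) = (\<chi> j. minus_part (x $ j)) + (\<chi> j. minus_part (y $ j))"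
    "(\<chi> j. plus_part ((x + y) $ j)) = (\<chi> j. plus_part (x $ j)) + (\<chi> j. plus_part (y $ j))"
    by (simp_all add: vec_eq_iff minus_part_def plus_part_def bicomplex_defs algebra_simps)
  then show "e_combine T1 T2 (x + y) = e_combine T1 T2 x + e_combine T1 T2 y"
    unfolding e_combine_def by (simp only: T1.add T2.add) (simp add: vec_eq_iff * algebra_simps)
  have "(\<chi> j. minus_part ((of_C1 c *s x) $ j)) = c *s (\<chi> j. minus_part (x $ j))"
    "(\<chi> j. plus_part ((of_C1 c *s x) $ j)) = c *s (\<chi> j. plus_part (x $ j))"
    by (simp_all add: vec_eq_iff minus_part_def plus_part_def of_C1_def bicomplex_defs algebra_simps)
  then show "e_combine T1 T2 (of_C1 c *s x) = of_C1 c *s e_combine T1 T2 x"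
    unfolding e_combine_def by (simp only: T1.scale T2.scale) (simp add: vec_eq_iff * algebra_simps)
qed

definition e_product ::
    "(complex ^ 'n \<Rightarrow> complex ^ 'n) set \<Rightarrow> (complex ^ 'n \<Rightarrow> complex ^ 'n) set \<Rightarrow>
     (bicomplex ^ 'n \<Rightarrow> bicomplex ^ 'n) set"  (infixr "\<times>\<^sub>e" 80) where
  "A \<times>\<^sub>e B = {e_combine T1 T2 | T1 T2. T1 \<in> A \<and> T2 \<in> B}"

definition is_eigenvalue :: "(bicomplex ^ 'n \<Rightarrow> bicomplex ^ 'n) \<Rightarrow> complex \<Rightarrow> bool" where
  "is_eigenvalue T \<mu> \<longleftrightarrow> (\<exists>x. x \<noteq> 0 \<and> T x = of_C1 \<mu> *s x)"

definition is_modified_eigenvalue ::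
    "(bicomplex ^ 'n \<Rightarrow> bicomplex ^ 'n) \<Rightarrow> bicomplex \<Rightarrow> bool" where
  "is_modified_eigenvalue T \<kappa> \<longleftrightarrow> (\<exists>x. x \<noteq> 0 \<and> T x = \<kappa> *s x)"

end

theory Submission
  imports Defs
begin

text \<open>
  The point is that \<open>T = e\<^sub>1T\<^sub>1 + e\<^sub>2T\<^sub>2\<close> commutes with multiplication by the idempotents \<open>e\<^sub>1\<close> and
  \<open>e\<^sub>2\<close> (lemmas \<open>e_combine_scale_e1\<close> and \<open>e_combine_scale_e2\<close>), while on the ideals which they
  generate a bicomplex scalar acts like a complex one: \<open>\<kappa> e\<^sub>1 = \<kappa>\<^sup>- e\<^sub>1\<close> and \<open>\<kappa> e\<^sub>2 = \<kappa>\<^sup>+ e\<^sub>2\<close>.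
  So if \<open>T x = \<kappa> x\<close>, then \<open>T (e\<^sub>1x) = \<kappa>\<^sup>- (e\<^sub>1x)\<close> and \<open>T (e\<^sub>2x) = \<kappa>\<^sup>+ (e\<^sub>2x)\<close>. As \<open>x = e\<^sub>1x + e\<^sub>2x\<close>, a
  nonzero \<open>x\<close> leaves at least one of \<open>e\<^sub>1x\<close> and \<open>e\<^sub>2x\<close> nonzero, and that vector is an eigenvector
  for a complex scalar. Conversely, a complex eigenvalue is a bicomplex scalar.
\<close>

lemma mult_e1: "\<kappa> * e1 = of_C1 (minus_part \<kappa>) * e1"
proof -
  have "\<kappa> = of_C1 (minus_part \<kappa>) * e1 + of_C1 (plus_part \<kappa>) * e2"
    using idempotent_decomposition by blast
  then have "\<kappa> * e1 =
      of_C1 (minus_part \<kappa>) * (e1 * e1) + of_C1 (plus_part \<kappa>) * (e1 * e2)"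
    by (metis distrib_right mult.assoc mult.commute)
  then show ?thesis by (simp add: idempotents)
qed

lemma mult_e2: "\<kappa> * e2 = of_C1 (plus_part \<kappa>) * e2"
proof -
  have "\<kappa> = of_C1 (minus_part \<kappa>) * e1 + of_C1 (plus_part \<kappa>) * e2"
    using idempotent_decomposition by blast
  then have "\<kappa> * e2 =
      of_C1 (minus_part \<kappa>) * (e1 * e2) + of_C1 (plus_part \<kappa>) * (e2 * e2)"
    by (metis distrib_right mult.assoc)
  then show ?thesis by (simp add: idempotents)
qed

lemma idempotent_parts_mult:
  "minus_part (e1 * \<xi>) = minus_part \<xi>" "plus_part (e1 * \<xi>) = 0"
  "minus_part (e2 * \<xi>) = 0" "plus_part (e2 * \<xi>) = plus_part \<xi>"
  using idempotent_decomposition[of "e1 * \<xi>" "minus_part \<xi>" 0]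
    idempotent_decomposition[of "e2 * \<xi>" 0 "plus_part \<xi>"] mult_e1[of \<xi>] mult_e2[of \<xi>]
  by (simp_all add: mult.commute of_C1_def flip: zero_bicomplex_def)

lemma L1_zero: "S \<in> L1 \<Longrightarrow> S 0 = 0"
  by (simp add: L1_def Vector_Spaces.linear.axioms linear_0 module_hom.zero
      Vector_Spaces.linear_iff_module_hom)

text \<open>
  Multiplying by \<open>e\<^sub>1\<close> keeps \<open>x\<^sup>-\<close> and replaces \<open>x\<^sup>+\<close> by \<open>0\<close>, so it deletes the \<open>e\<^sub>2\<close> summand of the
  image; by \<open>e\<^sub>1e\<^sub>1 = e\<^sub>1\<close> and \<open>e\<^sub>1e\<^sub>2 = 0\<close>, multiplying the image by \<open>e\<^sub>1\<close> has the same effect.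
\<close>

lemma e_combine_scale_e1:
  assumes "T2 \<in> L1"
  shows "e_combine T1 T2 (e1 *s x) = e1 *s e_combine T1 T2 x"
proof -
  have "e_combine T1 T2 (e1 *s x) = e1 *s (\<chi> i. of_C1 (T1 (\<chi> j. minus_part (x $ j)) $ i))"
    using L1_zero[OF assms]
    by (simp add: e_combine_def idempotent_parts_mult of_C1_def vec_eq_iff
        flip: zero_bicomplex_def zero_vec_def)
  also have "\<dots> = e1 *s e_combine T1 T2 x"
    by (simp add: e_combine_def vec_eq_iff distrib_left idempotents flip: mult.assoc)
  finally show ?thesis .
qed

lemma e_combine_scale_e2:
  assumes "T1 \<in> L1"
  shows "e_combine T1 T2 (e2 *s x) = e2 *s e_combine T1 T2 x"
proof -
  have "e2 * e1 = 0"
    by (simp add: idempotents mult.commute[of e2])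
  have "e_combine T1 T2 (e2 *s x) = e2 *s (\<chi> i. of_C1 (T2 (\<chi> j. plus_part (x $ j)) $ i))"
    using L1_zero[OF assms]
    by (simp add: e_combine_def idempotent_parts_mult of_C1_def vec_eq_iff
        flip: zero_bicomplex_def zero_vec_def)
  also have "\<dots> = e2 *s e_combine T1 T2 x"
    by (simp add: e_combine_def vec_eq_iff distrib_left idempotents \<open>e2 * e1 = 0\<close> flip: mult.assoc)
  finally show ?thesis .
qed

theorem theorem3p8:
  fixes T :: "bicomplex ^ 'n \<Rightarrow> bicomplex ^ 'n"
  assumes "T \<in> L1 \<times>\<^sub>e L1"
  shows "(\<exists>\<kappa>. is_modified_eigenvalue T \<kappa>) \<longleftrightarrow> (\<exists>\<mu>. is_eigenvalue T \<mu>)"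
proof
  assume "\<exists>\<kappa>. is_modified_eigenvalue T \<kappa>"
  then obtain \<kappa> x where x: "x \<noteq> 0" "T x = \<kappa> *s x"
    by (auto simp: is_modified_eigenvalue_def)
  obtain T1 T2 where T: "T = e_combine T1 T2" "T1 \<in> L1" "T2 \<in> L1"
    using assms by (auto simp: e_product_def)
  have "T (e1 *s x) = (\<kappa> * e1) *s x"
    using T x(2) by (simp add: e_combine_scale_e1 mult.commute)
  then have minus: "T (e1 *s x) = of_C1 (minus_part \<kappa>) *s (e1 *s x)"
    by (simp add: mult_e1[of \<kappa>])
  have "T (e2 *s x) = (\<kappa> * e2) *s x"
    using T x(2) by (simp add: e_combine_scale_e2 mult.commute)
  then have plus: "T (e2 *s x) = of_C1 (plus_part \<kappa>) *s (e2 *s x)"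
    by (simp add: mult_e2[of \<kappa>])
  have "x = e1 *s x + e2 *s x"
    by (simp add: idempotents flip: vector_sadd_rdistrib)
  with x(1) have "e1 *s x \<noteq> 0 \<or> e2 *s x \<noteq> 0"
    by auto
  with minus plus show "\<exists>\<mu>. is_eigenvalue T \<mu>"
    unfolding is_eigenvalue_def by blast
next
  assume "\<exists>\<mu>. is_eigenvalue T \<mu>"
  then show "\<exists>\<kappa>. is_modified_eigenvalue T \<kappa>"
    by (auto simp: is_eigenvalue_def is_modified_eigenvalue_def)
qed

end
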